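(* Let $A$, $B$, $B'$, $B''$, $C$, $C-A$ and $\mathbb{X}$ be positive stable matrices in $\mathbb{C}^{r\times r}$ such that $A$, $C$, $\mathbb{X}$ commute with each other and $CB=BC$, $CB'=B'C$, $CB''=B''C$. Then the extended Lauricella matrix function $F^{(3)}_{D,\mathbb{X}}(A,B,B',B'';C;z,w,v)$ of the complex variables $z,w,v$ has the following integral representation: $$F^{(3)}_{D,\mathbb{X}}(A,B,B',B'';C;z,w,v)=\Gamma(C)\Gamma^{-1}(A)\Gamma^{-1}(C-A)\int_{0}^{1}u^{A-I}(1-u)^{C-A-I}\exp\Big(\frac{-\mathbb{X}}{u(1-u)}\Big)(1-zu)^{-B}(1-wu)^{-B'}(1-vu)^{-B''}\,du .$$
   Context: $\mathbb{C}^{r\times r}$ is the space of complex $r\times r$ matrices and $I$ is the identity. A matrix is positive stable if all its eigenvalues have positive real part. Matrix powers are $t^{M}=\exp(M\log t)$; in particular $(1-s)^{-M}=\sum_{n\ge0}(M)_n\frac{s^n}{n!}$ for $|s|<1$. For positive stable $M$, $\Gamma(M)=\int_0^\infty e^{-t}t^{M-I}dt$, and $\Gamma^{-1}(M)$ is its inverse. The Pochhammer symbol is $(M)_0=I$, $(M)_n=M(M+I)\cdots(M+(n-1)I)$ for $n\ge1$. Extended beta matrix function: for commuting positive stable matrices $P,Q,\mathbb{X}$, $$\mathfrak{B}(P,Q;\mathbb{X})=\int_0^1 t^{P-I}(1-t)^{Q-I}\exp\Big(\frac{-\mathbb{X}}{t(1-t)}\Big)dt.$$ Extended Lauricella matrix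 function of three variables (under the matrix hypotheses of the claim; the order of the factors matters): $$F^{(3)}_{D,\mathbb{X}}(A,B,B',B'';C;z,w,v)=\Gamma(C)\Gamma^{-1}(A)\Gamma^{-1}(C-A)\sum_{m,n,p\ge0}\mathfrak{B}(A+(m+n+p)I,C-A;\mathbb{X})\,(B)_m(B')_n(B'')_p\frac{z^mw^nv^p}{m!\,n!\,p!}.$$ *)

theory Defs
  imports "HOL-Analysis.Analysis"
begin

text \<open>
  Matrices of size \<open>r\<close> by \<open>r\<close> are elements of \<^typ>\<open>complex^'r^'r\<close>. The ring operations of this type
  inherited from vectors (\<open>*\<close>, \<open>^\<close>, \<^const>\<open>exp\<close>) are entrywise or unavailable; the matrix product is
  \<open>**\<close> and the identity is \<open>mat 1\<close>, so powers and the exponential are set up here with respect to \<open>**\<close>.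
\<close>

definition mat_scale :: "complex \<Rightarrow> complex^'r^'r \<Rightarrow> complex^'r^'r"
  where "mat_scale c M = (\<chi> i j. c * M $ i $ j)"

definition positive_stable :: "complex^'r^'r \<Rightarrow> bool"
  where "positive_stable M \<longleftrightarrow> (\<forall>k x. x \<noteq> 0 \<and> M *v x = k *s x \<longrightarrow> Re k > 0)"

primrec mat_pow :: "complex^'r^'r \<Rightarrow> nat \<Rightarrow> complex^'r^'r"
  where
    "mat_pow M 0 = mat 1"
  | "mat_pow M (Suc n) = mat_pow M n ** M"

definition mat_exp :: "complex^'r^'r \<Rightarrow> complex^'r^'r"
  where "mat_exp M = (\<Sum>n. inverse (fact n) *\<^sub>R mat_pow M n)"

text \<open>
  The logarithm is the principal one, the real logarithm for \<open>t > 0\<close>. For \<open>\<bar>s\<bar> < 1\<close> the number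
  \<open>1 - s\<close> has positive real part, so \<open>mat_powr (1 - s) (- M)\<close> is the branch given by the binomial
  series.
\<close>

definition mat_powr :: "complex \<Rightarrow> complex^'r^'r \<Rightarrow> complex^'r^'r"
  where "mat_powr t M = mat_exp (mat_scale (Ln t) M)"

primrec mat_pochhammer :: "complex^'r^'r \<Rightarrow> nat \<Rightarrow> complex^'r^'r"
  where
    "mat_pochhammer M 0 = mat 1"
  | "mat_pochhammer M (Suc n) = mat_pochhammer M n ** (M + mat (of_nat n))"

definition mat_Gamma :: "complex^'r^'r \<Rightarrow> complex^'r^'r"
  where "mat_Gamma M =
    (LINT t:{0<..}|lborel. exp (- t) *\<^sub>R mat_powr (complex_of_real t) (M - mat 1))"

definition mat_ext_beta ::
    "complex^'r^'r \<Rightarrow> complex^'r^'r \<Rightarrow> complex^'r^'r \<Rightarrow> complex^'r^'r"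
  where "mat_ext_beta P Q X =
    (LINT t:{0<..<1}|lborel.
       mat_powr (complex_of_real t) (P - mat 1)
       ** mat_powr (complex_of_real (1 - t)) (Q - mat 1)
       ** mat_exp ((- 1 / (t * (1 - t))) *\<^sub>R X))"

definition ext_lauricella_term ::
    "complex^'r^'r \<Rightarrow> complex^'r^'r \<Rightarrow> complex^'r^'r \<Rightarrow> complex^'r^'r \<Rightarrow> complex^'r^'r
      \<Rightarrow> complex^'r^'r \<Rightarrow> complex \<Rightarrow> complex \<Rightarrow> complex \<Rightarrow> nat \<times> nat \<times> nat \<Rightarrow> complex^'r^'r"
  where "ext_lauricella_term X A B B' B'' C z w v = (\<lambda>(m, n, p).
    mat_scale (z ^ m * w ^ n * v ^ p / (fact m * fact n * fact p))
      (mat_ext_beta (A + mat (of_nat (m + n + p))) (C - A) X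
       ** mat_pochhammer B m ** mat_pochhammer B' n ** mat_pochhammer B'' p))"

definition ext_lauricella_FD3 ::
    "complex^'r^'r \<Rightarrow> complex^'r^'r \<Rightarrow> complex^'r^'r \<Rightarrow> complex^'r^'r \<Rightarrow> complex^'r^'r
      \<Rightarrow> complex^'r^'r \<Rightarrow> complex \<Rightarrow> complex \<Rightarrow> complex \<Rightarrow> complex^'r^'r"
  where "ext_lauricella_FD3 X A B B' B'' C z w v =
    mat_Gamma C ** matrix_inv (mat_Gamma A) ** matrix_inv (mat_Gamma (C - A))
    ** infsum (ext_lauricella_term X A B B' B'' C z w v) UNIV"

definition ext_lauricella_integrand ::
    "complex^'r^'r \<Rightarrow> complex^'r^'r \<Rightarrow> complex^'r^'r \<Rightarrow> complex^'r^'r \<Rightarrow> complex^'r^'r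
      \<Rightarrow> complex^'r^'r \<Rightarrow> complex \<Rightarrow> complex \<Rightarrow> complex \<Rightarrow> real \<Rightarrow> complex^'r^'r"
  where "ext_lauricella_integrand X A B B' B'' C z w v u =
    mat_powr (complex_of_real u) (A - mat 1)
    ** mat_powr (complex_of_real (1 - u)) (C - A - mat 1)
    ** mat_exp ((- 1 / (u * (1 - u))) *\<^sub>R X)
    ** mat_powr (1 - z * complex_of_real u) (- B)
    ** mat_powr (1 - w * complex_of_real u) (- B')
    ** mat_powr (1 - v * complex_of_real u) (- B'')"

end

theory Submission
  imports Defs "HOL-Complex_Analysis.Cauchy_Integral_Formula"
    "HOL-Computational_Algebra.Fundamental_Theorem_Algebra"
begin

text \<open>
  Expand each \<open>(1 - zu)\<^sup>-\<^sup>B\<close> in its binomial series and integrate termwise; the shift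
  \<open>A + (m+n+p)I\<close> only contributes the scalar \<open>u\<^bsup>m+n+p\<^esup>\<close>. The point is domination, since
  \<open>\<bar>z\<bar> = 1\<close> is allowed: the series of norms may grow like a negative power of \<open>1 - u\<close> as \<open>u\<close> tends to \<open>1\<close>.
  Positive stability of \<open>X\<close> makes \<open>exp (- sX)\<close> decay exponentially in \<open>s = 1/(u(1-u))\<close>, which
  beats all negative powers of \<open>u\<close> and \<open>1 - u\<close>. The decay comes from a polynomial annihilating \<open>X\<close>: its
  linear factors are removed one at a time, each by solving a scalar linear ODE.
\<close>

section \<open>Matrix norm and exponential\<close>

text \<open>The norm of nested vectors is the Frobenius norm. Row \<open>i\<close> of the product is
  a combination of the rows of \<open>Q\<close> with coefficients \<open>P $ i $ k\<close>, so the
  triangle inequality and Cauchy-Schwarz bound it.\<close>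

lemma norm_matrix_mult_le:
  fixes P :: "'a::real_normed_algebra_1^'n^'m" and Q :: "'a^'k^'n"
  shows "norm (P ** Q) \<le> norm P * norm Q"
proof -
  have row: "norm ((P ** Q) $ i) \<le> norm (P $ i) * norm Q" for i
  proof -
    have *: "(P ** Q) $ i = (\<Sum>k\<in>UNIV. \<chi> j. P $ i $ k * Q $ k $ j)"
      by (simp add: vec_eq_iff matrix_matrix_mult_def)
    have "norm ((P ** Q) $ i) \<le> (\<Sum>k\<in>UNIV. norm (P $ i $ k) * norm (Q $ k))"
      unfolding * 
    proof (rule sum_norm_le)
      fix k
      have "norm (\<chi> j. P $ i $ k * Q $ k $ j) \<le> L2_set (\<lambda>j. norm (P $ i $ k) * norm (Q $ k $ j)) UNIV"
        unfolding norm_vec_def[of "\<chi> j. P $ i $ k * Q $ k $ j"]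
        by (intro L2_set_mono) (auto intro: norm_mult_ineq)
      then show "norm (\<chi> j. P $ i $ k * Q $ k $ j) \<le> norm (P $ i $ k) * norm (Q $ k)"
        by (simp add: L2_set_right_distrib[symmetric] norm_vec_def)
    qed
    also have "\<dots> \<le> norm (P $ i) * norm Q"
      using L2_set_mult_ineq[of "\<lambda>k. norm (P $ i $ k)" "\<lambda>k. norm (Q $ k)" UNIV]
      by (simp add: norm_vec_def)
    finally show ?thesis .
  qed
  have "norm (P ** Q) \<le> L2_set (\<lambda>i. norm (P $ i) * norm Q) UNIV"
    unfolding norm_vec_def[of "P ** Q"] by (intro L2_set_mono row) auto
  also have "\<dots> = norm P * norm Q"
    by (simp add: L2_set_left_distrib[symmetric] norm_vec_def[of P])
  finally show ?thesis .
qed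

lemma bounded_bilinear_matrix_mult:
  "bounded_bilinear ((**) :: 'a::real_normed_algebra_1^'n^'m \<Rightarrow> 'a^'k^'n \<Rightarrow> 'a^'k^'m)"
proof
  show "\<exists>K. \<forall>(a::'a^'n^'m) (b::'a^'k^'n). norm (a ** b) \<le> norm a * norm b * K"
    using norm_matrix_mult_le by (intro exI[of _ 1]) auto
qed (auto simp: matrix_matrix_mult_def vec_eq_iff algebra_simps sum.distrib scaleR_sum_right)

lemmas bounded_linear_matrix_mult_left =
  bounded_bilinear.bounded_linear_left[OF bounded_bilinear_matrix_mult]

lemmas bounded_linear_matrix_mult_right =
  bounded_bilinear.bounded_linear_right[OF bounded_bilinear_matrix_mult]

lemma mat_scale_nth [simp]: "mat_scale c M $ i $ j = c * M $ i $ j"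
  by (simp add: mat_scale_def)

lemma norm_mat_scale: "norm (mat_scale c M) = norm c * norm M"
proof -
  have *: "norm (mat_scale c M $ i) = norm c * norm (M $ i)" for i
    by (simp add: norm_vec_def norm_mult L2_set_right_distrib)
  show ?thesis
    unfolding norm_vec_def[of "mat_scale c M"] norm_vec_def[of M] *
    by (simp add: L2_set_right_distrib)
qed

lemma mat_scale_mult_left: "mat_scale c M ** N = mat_scale c (M ** N)"
  by (simp add: vec_eq_iff matrix_matrix_mult_def sum_distrib_left mult_ac)

lemma mat_scale_mult_right: "M ** mat_scale c N = mat_scale c (M ** N)"
  by (simp add: vec_eq_iff matrix_matrix_mult_def sum_distrib_left mult_ac)

lemma mat_scale_mat_scale [simp]: "mat_scale c (mat_scale d M) = mat_scale (c * d) M"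
  by (simp add: vec_eq_iff mult_ac)

lemma mat_scale_add: "mat_scale c (M + N) = mat_scale c M + mat_scale c N"
  by (simp add: vec_eq_iff algebra_simps)

lemma mat_scale_one [simp]: "mat_scale 1 M = M"
  by (simp add: vec_eq_iff)

lemma mat_scale_zero [simp]: "mat_scale 0 M = 0"
  by (simp add: vec_eq_iff)

lemma mat_scale_zero_right [simp]: "mat_scale c 0 = 0"
  by (simp add: vec_eq_iff)

lemma mat_scale_of_real: "mat_scale (of_real a) M = a *\<^sub>R M"
  by (simp add: vec_eq_iff scaleR_conv_of_real[where ?'a = complex])

lemma mat_eq_mat_scale: "mat c = mat_scale c (mat 1)"
  by (simp add: vec_eq_iff mat_def)

lemma mult_mat: "(M :: complex^'r^'r) ** mat c = mat_scale c M"
  by (subst mat_eq_mat_scale) (simp add: mat_scale_mult_right)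

section \<open>Powers and the exponential: norm bounds and entrywise analysis\<close>

lemma mat_pow_mat_scale: "mat_pow (mat_scale c M) n = mat_scale (c ^ n) (mat_pow M n)"
  by (induction n) (simp_all add: mat_scale_mult_left mat_scale_mult_right mult_ac)

lemma mat_pow_commute: "M ** mat_pow M n = mat_pow M n ** M"
  by (induction n) (simp_all add: matrix_mul_assoc)

text \<open>The case \<open>n = 0\<close> forces the factor \<open>norm (mat 1)\<close>: the
  Frobenius norm of the identity is the square root of the dimension, not 1. It persists in all
  later bounds.\<close>

lemma norm_mat_pow_le: "norm (mat_pow M n) \<le> norm (mat 1 :: complex^'r^'r) * norm (M :: complex^'r^'r) ^ n"
proof (induction n)
  case (Suc n)
  have "norm (mat_pow M (Suc n)) \<le> norm (mat_pow M n) * norm M"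
    by (simp add: norm_matrix_mult_le)
  also have "\<dots> \<le> norm (mat 1 :: complex^'r^'r) * norm M ^ n * norm M"
    by (intro mult_right_mono Suc) auto
  finally show ?case by (simp add: mult_ac)
qed auto

lemma
  fixes M :: "complex^'r^'r"
  shows summable_mat_exp: "summable (\<lambda>n. norm (inverse (fact n) *\<^sub>R mat_pow M n))"
    and norm_mat_exp_le: "norm (mat_exp M) \<le> norm (mat 1 :: complex^'r^'r) * exp (norm M)"
proof -
  let ?g = "\<lambda>n. norm (mat 1 :: complex^'r^'r) * (norm M ^ n /\<^sub>R fact n)"
  have s: "?g sums (norm (mat 1 :: complex^'r^'r) * exp (norm M))"
    by (intro sums_mult exp_converges)
  have le: "norm (inverse (fact n) *\<^sub>R mat_pow M n) \<le> ?g n" for n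
    using mult_left_mono[OF norm_mat_pow_le[of M n], of "inverse (fact n)"] by (simp add: mult_ac)
  show sm: "summable (\<lambda>n. norm (inverse (fact n) *\<^sub>R mat_pow M n))"
    by (rule summable_comparison_test'[OF sums_summable[OF s], of 0]) (use le in auto)
  have "norm (mat_exp M) \<le> (\<Sum>n. norm (inverse (fact n) *\<^sub>R mat_pow M n))"
    unfolding mat_exp_def by (rule summable_norm[OF sm])
  also have "\<dots> \<le> suminf ?g"
    by (rule suminf_le[OF le sm sums_summable[OF s]])
  finally show "norm (mat_exp M) \<le> norm (mat 1 :: complex^'r^'r) * exp (norm M)"
    using sums_unique[OF s] by simp
qed

lemma mat_exp_sums: "(\<lambda>n. inverse (fact n) *\<^sub>R mat_pow M n) sums mat_exp M"
  unfolding mat_exp_def by (intro summable_sums summable_norm_cancel[OF summable_mat_exp])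

text \<open>Each entry of the exponential is a scalar power series in \<open>c\<close> that
  converges everywhere, so scalar complex analysis applies entry by entry.\<close>

lemma mat_exp_nth_sums: "(\<lambda>n. mat_pow M n $ i $ j / fact n * c ^ n) sums (mat_exp (mat_scale c M) $ i $ j)"
proof -
  have "(\<lambda>n. (inverse (fact n) *\<^sub>R mat_pow (mat_scale c M) n) $ i $ j) sums (mat_exp (mat_scale c M) $ i $ j)"
    by (intro bounded_linear.sums[OF bounded_linear_vec_nth] mat_exp_sums)
  then show ?thesis
    by (simp add: mat_pow_mat_scale scaleR_conv_of_real[where ?'a = complex] divide_inverse mult_ac)
qed

lemma mat_exp_zero [simp]: "mat_exp (0 :: complex^'r^'r) = mat 1"
proof -
  have "mat_exp (mat_scale 0 0) $ i $ j = (mat 1 :: complex^'r^'r) $ i $ j" for i j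
    using sums_unique2[OF mat_exp_nth_sums[of 0 i j 0]
        powser_sums_zero[of "\<lambda>n. mat_pow (0 :: complex^'r^'r) n $ i $ j / fact n"]] by simp
  then show "mat_exp (0 :: complex^'r^'r) = mat 1" by (simp add: vec_eq_iff)
qed

text \<open>Termwise differentiation: \<open>diffs\<close> shifts the coefficients and multiplies by
  \<open>n + 1\<close>, which cancels in \<open>fact (Suc n)\<close> and leaves one extra factor
  \<open>M\<close>.\<close>

lemma mat_exp_nth_has_field_derivative:
  fixes M :: "complex^'r^'r"
  shows "((\<lambda>c. mat_exp (mat_scale c M) $ i $ j) has_field_derivative
           (M ** mat_exp (mat_scale c M)) $ i $ j) (at c)"
proof -
  let ?a = "\<lambda>n. mat_pow M n $ i $ j / fact n"
  have eq: "mat_exp (mat_scale c M) $ i $ j = (\<Sum>n. ?a n * c ^ n)" for c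
    using sums_unique[OF mat_exp_nth_sums] by blast
  have "(\<lambda>n. (M ** (inverse (fact n) *\<^sub>R mat_pow (mat_scale c M) n)) $ i $ j)
          sums ((M ** mat_exp (mat_scale c M)) $ i $ j)"
    by (intro bounded_linear.sums[OF bounded_linear_vec_nth]
        bounded_linear.sums[OF bounded_linear_matrix_mult_right] mat_exp_sums)
  also have "(\<lambda>n. (M ** (inverse (fact n) *\<^sub>R mat_pow (mat_scale c M) n)) $ i $ j) =
      (\<lambda>n. diffs ?a n * c ^ n)"
  proof
    fix n
    have *: "inverse (fact n) *\<^sub>R N = mat_scale (inverse (fact n)) N" for N :: "complex^'r^'r"
      by (simp add: vec_eq_iff scaleR_conv_of_real[where ?'a = complex])
    show "(M ** (inverse (fact n) *\<^sub>R mat_pow (mat_scale c M) n)) $ i $ j = diffs ?a n * c ^ n"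
      unfolding *
      by (simp add: mat_scale_mult_right mat_pow_mat_scale mat_pow_commute diffs_def field_simps del: of_nat_Suc)
  qed
  finally have "(\<Sum>n. diffs ?a n * c ^ n) = (M ** mat_exp (mat_scale c M)) $ i $ j"
    by (rule sums_unique[symmetric])
  moreover have "((\<lambda>c. \<Sum>n. ?a n * c ^ n) has_field_derivative (\<Sum>n. diffs ?a n * c ^ n)) (at c)"
    by (intro termdiffs_strong_converges_everywhere sums_summable[OF mat_exp_nth_sums])
  ultimately show ?thesis by (simp add: eq)
qed

lemma mat_exp_commute: "M ** mat_exp (mat_scale c M) = mat_exp (mat_scale c M) ** M"
proof -
  have "(\<lambda>n. M ** (inverse (fact n) *\<^sub>R mat_pow (mat_scale c M) n)) sums (M ** mat_exp (mat_scale c M))"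
    by (intro bounded_linear.sums[OF bounded_linear_matrix_mult_right] mat_exp_sums)
  moreover have "(\<lambda>n. (inverse (fact n) *\<^sub>R mat_pow (mat_scale c M) n) ** M) sums (mat_exp (mat_scale c M) ** M)"
    by (intro bounded_linear.sums[OF bounded_linear_matrix_mult_left] mat_exp_sums)
  moreover have "M ** (inverse (fact n) *\<^sub>R mat_pow (mat_scale c M) n) = (inverse (fact n) *\<^sub>R mat_pow (mat_scale c M) n) ** M" for n
    by (simp add: mat_pow_mat_scale mat_scale_mult_left mat_scale_mult_right mat_pow_commute
       flip: mat_scale_of_real)
  ultimately show ?thesis by (simp add: sums_unique2)
qed

section \<open>Binomial series and powers\<close>

text \<open>A chain in which each function has the next one as derivative lists all derivatives of
  \<open>f 0\<close>; a function holomorphic on a disc is the sum of its Taylor series there.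
  Guessing the whole chain thus identifies a power series.\<close>

lemma higher_derivative_sequence_sums:
  fixes f :: "nat \<Rightarrow> complex \<Rightarrow> complex"
  assumes der: "\<And>n s. s \<in> ball 0 R \<Longrightarrow> (f n has_field_derivative f (Suc n) s) (at s)"
    and "s \<in> ball 0 R"
  shows "(\<lambda>n. f n 0 / fact n * s ^ n) sums f 0 s"
proof -
  have hd: "(deriv ^^ n) (f 0) x = f n x" if "x \<in> ball 0 R" for n x
    using that
  proof (induction n arbitrary: x)
    case (Suc n)
    \<comment> \<open>The derivative at \<open>x\<close> sees only values near \<open>x\<close>, and
      the ball is open, so the induction hypothesis may be used on a neighbourhood.\<close>
    have "\<forall>\<^sub>F y in nhds x. (deriv ^^ n) (f 0) y = f n y"
      using eventually_nhds_in_open[OF open_ball Suc.prems] by eventually_elim (rule Suc.IH)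
    then have "deriv ((deriv ^^ n) (f 0)) x = deriv (f n) x"
      by (rule deriv_cong_ev) simp
    then show ?case
      using DERIV_imp_deriv[OF der[OF Suc.prems]] by simp
  qed auto
  have "f 0 holomorphic_on ball 0 R"
    using der by (intro holomorphic_onI) (meson field_differentiable_at_within field_differentiable_def)
  moreover have "R > 0"
    using assms(2) by (metis dist_0_norm mem_ball norm_ge_zero order_le_less_trans)
  ultimately show ?thesis
    using holomorphic_power_series[of "f 0" 0 R s] hd[of 0] assms(2) by simp
qed

text \<open>The n-th derivative of \<open>(1 - s)\<close> to the power \<open>- B\<close> is
  \<open>(B)_n\<close> times that power divided by \<open>(1 - s) ^ n\<close>. In the next
  derivative the exponential contributes \<open>B\<close> and the denominator contributes
  \<open>n\<close>, which together form the new Pochhammer factor.\<close>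

lemma mat_binomial_series:
  fixes B :: "complex^'r^'r"
  assumes s: "norm s < 1"
  shows "(\<lambda>n. mat_scale (s ^ n / fact n) (mat_pochhammer B n)) sums mat_powr (1 - s) (- B)"
proof -
  \<comment> \<open>Entry \<open>i\<close>, \<open>j\<close> of the n-th derivative. At
    \<open>s = 0\<close> the logarithm vanishes, the exponential is \<open>mat 1\<close>, and the
    Pochhammer matrix remains.\<close>
  define f where "f = (\<lambda>i j n s. (mat_pochhammer B n ** mat_exp (mat_scale (Ln (1 - s)) (- B))) $ i $ j
     / (1 - s) ^ n)"
  \<comment> \<open>Simplifies the quotient rule. The case \<open>n = 0\<close> is separate because
    there \<open>n - 1\<close> is truncated; the factor \<open>of_nat n\<close> makes that term
    vanish.\<close>
  have quot: "(a / y * y ^ n - b * (- of_nat n * y ^ (n - 1))) / (y ^ n * y ^ n) = (a + of_nat n * b) / y ^ Suc n"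
    if "y \<noteq> 0" for a b y :: complex and n
    using that by (cases n) (simp_all add: divide_simps, simp add: algebra_simps)
  have nth: "(\<lambda>n. f i j n 0 / fact n * s ^ n) sums f i j 0 s" for i j
  proof (rule higher_derivative_sequence_sums)
    fix n and x :: complex assume "x \<in> ball 0 1"
    then have x: "norm x < 1" by simp
    \<comment> \<open>This keeps \<open>1 - x\<close> off the branch cut of
      \<open>Ln\<close>.\<close>
    then have "Re x < 1" using complex_Re_le_cmod[of x] by linarith
    then have np: "1 - x \<notin> \<real>\<^sub>\<le>\<^sub>0" and nz: "1 - x \<noteq> 0" by (auto simp: complex_nonpos_Reals_iff)
    let ?E = "mat_exp (mat_scale (Ln (1 - x)) (- B))"
    let ?P = "mat_pochhammer B n"
    have dE: "((\<lambda>s. mat_exp (mat_scale (Ln (1 - s)) (- B)) $ k $ j) has_field_derivative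
       (B ** ?E) $ k $ j / (1 - x)) (at x)" for k
    proof -
      have "((\<lambda>s. Ln (1 - s)) has_field_derivative - inverse (1 - x)) (at x)"
        using np by (auto intro!: derivative_eq_intros simp: divide_inverse)
      from DERIV_chain2[OF mat_exp_nth_has_field_derivative[of "-B" k j] this]
      show ?thesis by (simp add: divide_inverse matrix_matrix_mult_def sum_negf)
    qed
    have "((\<lambda>s. (\<Sum>k\<in>UNIV. ?P $ i $ k * mat_exp (mat_scale (Ln (1 - s)) (- B)) $ k $ j) / (1 - s) ^ n)
       has_field_derivative
         ((\<Sum>k\<in>UNIV. ?P $ i $ k * ((B ** ?E) $ k $ j / (1 - x))) * (1 - x) ^ n 
          - (\<Sum>k\<in>UNIV. ?P $ i $ k * ?E $ k $ j) * (- of_nat n * (1 - x) ^ (n - 1))) / ((1 - x) ^ n * (1 - x) ^ n)) (at x)"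
      using nz by (auto intro!: derivative_eq_intros dE simp: mult.commute)
    also have "(\<Sum>k\<in>UNIV. ?P $ i $ k * ((B ** ?E) $ k $ j / (1 - x))) = (?P ** B ** ?E) $ i $ j / (1 - x)"
      by (simp add: sum_divide_distrib matrix_matrix_mult_def[of ?P "B ** ?E"] mult.commute flip: matrix_mul_assoc)
    also have "(\<Sum>k\<in>UNIV. ?P $ i $ k * ?E $ k $ j) = (?P ** ?E) $ i $ j"
      by (simp add: matrix_matrix_mult_def[of ?P])
    also have "((?P ** B ** ?E) $ i $ j / (1 - x) * (1 - x) ^ n - (?P ** ?E) $ i $ j * (- of_nat n * (1 - x) ^ (n - 1)))
       / ((1 - x) ^ n * (1 - x) ^ n) =
       ((?P ** B ** ?E) $ i $ j + of_nat n * (?P ** ?E) $ i $ j) / (1 - x) ^ Suc n"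
      using quot[of "1 - x"] nz by simp
    also have "(?P ** B ** ?E) $ i $ j + of_nat n * (?P ** ?E) $ i $ j = (mat_pochhammer B (Suc n) ** ?E) $ i $ j"
      by (simp add: matrix_add_ldistrib bounded_bilinear.add_left[OF bounded_bilinear_matrix_mult] mult_mat mat_scale_mult_left)
    finally show "(f i j n has_field_derivative f i j (Suc n) x) (at x)"
      unfolding f_def by (simp add: matrix_matrix_mult_def)
  qed (use s in auto)
  have "(\<lambda>n. (mat_scale (s ^ n / fact n) (mat_pochhammer B n)) $ i $ j) sums (mat_powr (1 - s) (- B) $ i $ j)" for i j
    using nth[of i j] by (simp add: f_def mat_powr_def mult_ac)
  then show ?thesis
    unfolding sums_def by (intro vec_tendstoI) (simp add: sum_component)
qed

text \<open>The product of \<open>exp (s(M + I))\<close> and the scalar \<open>exp (- s)\<close> has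
  n-th derivative \<open>M^n\<close> times itself, because differentiating the scalar cancels the
  identity. At 0 these derivatives are \<open>M^n\<close>, so the Taylor series is that of
  \<open>exp (sM)\<close>.\<close>

lemma mat_powr_add_mat_one:
  fixes M :: "complex^'r^'r"
  assumes "t \<noteq> 0"
  shows "mat_powr t (M + mat 1) = mat_scale t (mat_powr t M)"
proof -
  define f where "f = (\<lambda>i j n s. (mat_pow M n ** mat_exp (mat_scale s (M + mat 1))) $ i $ j * exp (- s))"
  let ?L = "Ln t"
  have nth: "(\<lambda>n. f i j n 0 / fact n * ?L ^ n) sums f i j 0 ?L" for i j
  proof (rule higher_derivative_sequence_sums)
    fix n and x :: complex
    let ?E = "mat_exp (mat_scale x (M + mat 1))"
    let ?P = "mat_pow M n"
    have "((\<lambda>s. (\<Sum>k\<in>UNIV. ?P $ i $ k * mat_exp (mat_scale s (M + mat 1)) $ k $ j) * exp (- s))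
       has_field_derivative
         ((\<Sum>k\<in>UNIV. ?P $ i $ k * ((M + mat 1) ** ?E) $ k $ j) * exp (- x)
          - (\<Sum>k\<in>UNIV. ?P $ i $ k * ?E $ k $ j) * exp (- x))) (at x)"
      by (auto intro!: derivative_eq_intros mat_exp_nth_has_field_derivative simp: mult.commute)
    also have "(\<Sum>k\<in>UNIV. ?P $ i $ k * ((M + mat 1) ** ?E) $ k $ j) = (?P ** (M + mat 1) ** ?E) $ i $ j"
      by (simp add: matrix_matrix_mult_def[of ?P "(M + mat 1) ** ?E"] flip: matrix_mul_assoc)
    also have "(\<Sum>k\<in>UNIV. ?P $ i $ k * ?E $ k $ j) = (?P ** ?E) $ i $ j"
      by (simp add: matrix_matrix_mult_def[of ?P])
    also have "(?P ** (M + mat 1) ** ?E) $ i $ j * exp (- x) - (?P ** ?E) $ i $ j * exp (- x) = f i j (Suc n) x"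
      by (simp add: f_def matrix_add_ldistrib bounded_bilinear.add_left[OF bounded_bilinear_matrix_mult] algebra_simps)
    finally show "(f i j n has_field_derivative f i j (Suc n) x) (at x)"
      unfolding f_def by (simp add: matrix_matrix_mult_def)
  next
    \<comment> \<open>The chain of derivatives holds on the whole plane, so any radius beyond
      \<open>norm ?L\<close> serves.\<close>
    show "?L \<in> ball 0 (norm ?L + 1)" by simp
  qed
  \<comment> \<open>Both series agree at \<open>s = Ln t\<close>, where \<open>exp (- s)\<close> is
    \<open>1 / t\<close>.\<close>
  have "mat_exp (mat_scale ?L (M + mat 1)) $ i $ j / t = mat_exp (mat_scale ?L M) $ i $ j" for i j
    using sums_unique2[OF nth[of i j], of "mat_exp (mat_scale ?L M) $ i $ j"]
      mat_exp_nth_sums[of M i j ?L] assms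
    by (simp add: f_def exp_minus divide_inverse)
  then show ?thesis
    using assms by (simp add: mat_powr_def vec_eq_iff field_simps)
qed

lemma mat_powr_add_mat_of_nat:
  fixes M :: "complex^'r^'r"
  assumes "t \<noteq> 0"
  shows "mat_powr t (M + mat (of_nat n)) = mat_scale (t ^ n) (mat_powr t M)"
proof (induction n)
  case (Suc n)
  have "M + mat (of_nat (Suc n)) = (M + mat (of_nat n)) + mat 1"
    by (simp add: vec_eq_iff mat_def)
  then show ?case
    using mat_powr_add_mat_one[OF assms, of "M + mat (of_nat n)"] Suc by (metis mat_scale_mat_scale power_Suc)
qed (simp add: mat_0)

section \<open>Exponential decay for positive stable matrices\<close>

lemma has_vector_derivative_vecI:
  fixes f :: "real \<Rightarrow> 'a::real_normed_vector^'n"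
  assumes "\<And>i. ((\<lambda>t. f t $ i) has_vector_derivative f' $ i) (at t)"
  shows "(f has_vector_derivative f') (at t)"
  unfolding has_vector_derivative_def has_derivative_within
proof (intro conjI vec_tendstoI bounded_linear_scaleR_left)
  fix i
  show "((\<lambda>y. ((1 / norm (y - t)) *\<^sub>R (f y - (f t + (y - t) *\<^sub>R f'))) $ i) \<longlongrightarrow> 0 $ i) (at t)"
    using assms[of i] unfolding has_vector_derivative_def has_derivative_within by simp
qed

section \<open>Polynomials in a matrix, evaluated by Horner's scheme with the matrix product\<close>

definition mat_poly :: "complex poly \<Rightarrow> complex^'r^'r \<Rightarrow> complex^'r^'r"
  where "mat_poly p M = fold_coeffs (\<lambda>a N. mat a + M ** N) p 0"

lemma mat_poly_0 [simp]: "mat_poly 0 M = 0"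
  by (simp add: mat_poly_def)

lemma mat_poly_pCons [simp]: "mat_poly (pCons a p) M = mat a + M ** mat_poly p M"
  \<comment> \<open>When both vanish, \<open>pCons a p\<close> is the zero polynomial and there is
    no coefficient to fold over.\<close>
  by (cases "p = 0 \<and> a = 0") (auto simp: mat_poly_def)

lemma mat_add: "mat (a + b) = mat a + (mat b :: 'a::comm_monoid_add^'n^'n)"
  by (simp add: vec_eq_iff mat_def)

lemma mat_poly_add: "mat_poly (p + q) M = mat_poly p M + mat_poly q M"
  by (induction p q rule: poly_induct2) (simp_all add: matrix_add_ldistrib mat_add algebra_simps)

lemma mat_poly_smult: "mat_poly (smult c p) M = mat_scale c (mat_poly p M)"
proof (induction p)
  case (pCons a p)
  have "mat (c * a) = mat_scale c (mat a)"
    by (simp add: vec_eq_iff mat_def)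
  then show ?case
    by (simp add: pCons.IH mat_scale_add mat_scale_mult_right)
qed simp

lemma mat_poly_sum: "mat_poly (\<Sum>i\<in>I. p i) M = (\<Sum>i\<in>I. mat_poly (p i) M)"
  by (induction I rule: infinite_finite_induct) (simp_all add: mat_poly_add)

lemma mat_poly_monom: "mat_poly (monom c n) M = mat_scale c (mat_pow M n)"
proof (induction n)
  case 0
  show ?case by (simp add: monom_0 mat_eq_mat_scale[of c])
next
  case (Suc n)
  then show ?case by (simp add: monom_Suc mat_scale_mult_right mat_pow_commute)
qed

lemma mat_poly_commute: "M ** mat_poly p M = mat_poly p M ** M"
proof (induction p)
  case (pCons a p)
  have "M ** mat_poly (pCons a p) M = mat_scale a M + M ** (M ** mat_poly p M)"
    by (simp add: matrix_add_ldistrib mult_mat)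
  also have "M ** (M ** mat_poly p M) = M ** mat_poly p M ** M"
    by (simp add: pCons.IH matrix_mul_assoc)
  also have "mat_scale a M = mat a ** M"
    by (simp add: mat_eq_mat_scale[of a] mat_scale_mult_left)
  finally show ?case
    by (simp add: bounded_bilinear.add_left[OF bounded_bilinear_matrix_mult])
qed simp

text \<open>The second form moves the factor towards a matrix standing on the right, for the
  differential equation; the first leaves it outermost, where it can be cancelled if it is
  injective.\<close>

lemma mat_poly_linear_factor:
  "mat_poly ([:- l, 1:] * q) M = (M - mat l) ** mat_poly q M"
  "mat_poly ([:- l, 1:] * q) M = mat_poly q M ** (M - mat l)"
proof -
  have "[:- l, 1:] * q = smult (- l) q + pCons 0 q" by simp
  then have *: "mat_poly ([:- l, 1:] * q) M = M ** mat_poly q M - mat_scale l (mat_poly q M)"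
    by (simp only: mat_poly_add mat_poly_smult) (simp add: vec_eq_iff)
  show "mat_poly ([:- l, 1:] * q) M = (M - mat l) ** mat_poly q M"
    unfolding *
    by (simp add: bounded_bilinear.diff_left[OF bounded_bilinear_matrix_mult] mat_eq_mat_scale[of l] mat_scale_mult_left)
  show "mat_poly ([:- l, 1:] * q) M = mat_poly q M ** (M - mat l)"
    unfolding *
    by (simp add: bounded_bilinear.diff_right[OF bounded_bilinear_matrix_mult] mult_mat mat_poly_commute)
qed

text \<open>The powers of \<open>M\<close> lie in a real vector space of finite dimension, so they
  cannot be infinitely many independent vectors.\<close>

lemma exists_annihilating_poly:
  fixes M :: "complex^'r^'r"
  obtains p where "p \<noteq> 0" and "mat_poly p M = 0"
\<comment> \<open>Linear dependence speaks of the set of powers and misses repetitions. Two equal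
  powers give an annihilating difference of monomials directly.\<close>
proof (cases "inj (mat_pow M)")
  case False
  then obtain a b where ab: "a \<noteq> b" "mat_pow M a = mat_pow M b"
    by (auto simp: inj_def)
  define p :: "complex poly" where "p = monom 1 a + monom (-1) b"
  have "coeff p a = 1"
    using ab(1) by (simp add: p_def)
  then have "p \<noteq> 0" by auto
  moreover have "mat_poly p M = 0"
    using ab(2) by (simp add: p_def mat_poly_add mat_poly_monom vec_eq_iff)
  ultimately show ?thesis using that by blast
next
  case True
  let ?S = "range (mat_pow M)"
  have "infinite ?S"
    using True by (simp add: finite_image_iff)
  then have "dependent ?S"
    using independent_bound by blast
  then obtain t u where t: "finite t" "t \<subseteq> ?S" "(\<Sum>v\<in>t. u v *\<^sub>R v) = 0" and "\<exists>v\<in>t. u v \<noteq> 0"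
    unfolding dependent_explicit by blast
  then obtain n0 where n0: "mat_pow M n0 \<in> t" "u (mat_pow M n0) \<noteq> 0"
    by blast
  \<comment> \<open>By injectivity the matrices in the relation correspond to exponents, so its
    coefficients become those of a polynomial.\<close>
  define I where "I = mat_pow M -` t"
  have I: "finite I" "t = mat_pow M ` I"
    using t True by (auto simp: I_def intro: finite_vimageI)
  define p :: "complex poly" where "p = (\<Sum>n\<in>I. monom (of_real (u (mat_pow M n))) n)"
  have "coeff p n0 = of_real (u (mat_pow M n0))"
    using n0(1) I(1) by (simp add: p_def coeff_sum I_def sum.delta)
  then have "p \<noteq> 0" using n0(2) by auto
  moreover have "mat_poly p M = (\<Sum>v\<in>t. u v *\<^sub>R v)"
    unfolding p_def I(2)
    using True by (subst sum.reindex)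
      (auto simp: mat_poly_sum mat_poly_monom mat_scale_of_real inj_on_def inj_def)
  ultimately show ?thesis using that t(3) by auto
qed

text \<open>A nonzero vector in the range of \<open>Y\<close> would be an eigenvector of
  \<open>X\<close> with eigenvalue \<open>l\<close>.\<close>

lemma positive_stable_kernel:
  assumes "positive_stable X" "Re l \<le> 0" "(X - mat l) ** Y = 0"
  shows "Y = 0"
proof -
  have "Y *v x = 0" for x
  proof (rule ccontr)
    assume "Y *v x \<noteq> 0"
    have "((X - mat l) ** Y) *v x = 0"
      by (simp add: assms(3))
    then have "X *v (Y *v x) = mat l *v (Y *v x)"
      by (simp add: matrix_vector_mult_diff_rdistrib flip: matrix_vector_mul_assoc)
    also have "\<dots> = l *s (Y *v x)"
      by (simp add: vec_eq_iff matrix_vector_mult_def mat_def if_distrib if_distribR cong: if_cong)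
    finally show False
      using assms(1,2) \<open>Y *v x \<noteq> 0\<close> unfolding positive_stable_def by fastforce
  qed
  then show ?thesis
    by (metis matrix_eq matrix_vector_mult_0)
qed

text \<open>The right factor \<open>Y\<close> makes the removal of linear factors an induction:
  factors taken off the polynomial are moved into \<open>Y\<close>. The goal is the case
  \<open>Y = mat 1\<close>.\<close>

definition exp_decaying :: "complex^'r^'r \<Rightarrow> complex^'r^'r \<Rightarrow> bool"
  where "exp_decaying X Y \<longleftrightarrow>
    (\<exists>K c. c > 0 \<and> (\<forall>s\<ge>0. norm (mat_exp ((- s) *\<^sub>R X) ** Y) \<le> K * exp (- c * s)))"

lemma mat_exp_scaleR_has_vector_derivative:
  "((\<lambda>s. mat_exp ((- s) *\<^sub>R X)) has_vector_derivative - (mat_exp ((- s) *\<^sub>R X) ** X)) (at s)"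
proof (intro has_vector_derivative_vecI)
  fix i j
  have "((\<lambda>s. of_real (- s) :: complex) has_vector_derivative - 1) (at s)"
    by (auto intro!: derivative_eq_intros)
  from field_vector_diff_chain_at[OF this mat_exp_nth_has_field_derivative]
  show "((\<lambda>s. mat_exp ((- s) *\<^sub>R X) $ i $ j) has_vector_derivative (- (mat_exp ((- s) *\<^sub>R X) ** X)) $ i $ j) (at s)"
    by (simp add: o_def mat_exp_commute flip: mat_scale_of_real)
qed

text \<open>
  With \<open>f s = exp (- sX) Y\<close>, the derivative of \<open>exp (ls) f s\<close> is \<open>- exp (ls) exp (- sX) (X - l) Y\<close>,
  which the hypothesis bounds.
\<close>

lemma exp_decaying_step:
  fixes X Y :: "complex^'r^'r"
  assumes "exp_decaying X ((X - mat l) ** Y)" and l: "Re l > 0"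
  shows "exp_decaying X Y"
proof -
  let ?E = "\<lambda>s. mat_exp ((- s) *\<^sub>R X)"
  let ?Z = "(X - mat l) ** Y"
  obtain K c where c: "c > 0" and K: "\<And>s. s \<ge> 0 \<Longrightarrow> norm (?E s ** ?Z) \<le> K * exp (- c * s)"
    using assms(1) unfolding exp_decaying_def by blast
  \<comment> \<open>The rate must not exceed \<open>c\<close>, so that the known bound survives, and
    must be strictly below \<open>Re l\<close>, so that the integral of
    \<open>exp ((Re l - d) * s)\<close> has a positive denominator.\<close>
  define d where "d = min c (Re l / 2)"
  have d: "d > 0" "d \<le> c" "d < Re l" using c l by (auto simp: d_def)
  have "K \<ge> 0" using order_trans[OF norm_ge_zero K[of 0]] by simp
  have K': "norm (?E s ** ?Z) \<le> K * exp (- d * s)" if "s \<ge> 0" for s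
  proof -
    have "K * exp (- c * s) \<le> K * exp (- d * s)"
      using \<open>K \<ge> 0\<close> d that by (intro mult_left_mono) (auto intro: mult_right_mono)
    then show ?thesis using K[OF that] by linarith
  qed
  define g where "g s = mat_scale (exp (of_real s * l)) (?E s ** Y)" for s :: real
  define g' where "g' s = mat_scale (- exp (of_real s * l)) (?E s ** ?Z)" for s :: real
  \<comment> \<open>An antiderivative of the bound on \<open>norm (g' s)\<close>, as the mean value
    inequality requires.\<close>
  define \<phi> where "\<phi> s = K / (Re l - d) * exp ((Re l - d) * s)" for s :: real
  have dEY: "((\<lambda>s. ?E s ** Y) has_vector_derivative - (?E s ** X ** Y)) (at s)" for s
    using bounded_linear.has_vector_derivative[OF bounded_linear_matrix_mult_left[of Y] mat_exp_scaleR_has_vector_derivative]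
    by (simp add: bounded_bilinear.minus_left[OF bounded_bilinear_matrix_mult])
  have dg: "(g has_vector_derivative g' s) (at s)" for s
  proof (intro has_vector_derivative_vecI)
    fix i j
    have de: "((\<lambda>s. exp (of_real s * l)) has_vector_derivative exp (of_real s * l) * l) (at s)"
    proof -
      have "((\<lambda>s. of_real s :: complex) has_vector_derivative 1) (at s)"
        by (auto intro!: derivative_eq_intros)
      moreover have "((\<lambda>z. exp (z * l)) has_field_derivative exp (of_real s * l) * l) (at (of_real s))"
        by (auto intro!: derivative_eq_intros)
      ultimately show ?thesis
        using field_vector_diff_chain_at by (fastforce simp: o_def)
    qed
    have "((\<lambda>s. (?E s ** Y) $ i $ j) has_vector_derivative (- (?E s ** X ** Y)) $ i $ j) (at s)"
      by (intro bounded_linear.has_vector_derivative[OF bounded_linear_vec_nth] dEY)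
    from has_vector_derivative_mult[OF de this]
    have "((\<lambda>s. g s $ i $ j) has_vector_derivative
        exp (of_real s * l) * (- (?E s ** X ** Y)) $ i $ j + exp (of_real s * l) * l * (?E s ** Y) $ i $ j) (at s)"
      by (simp add: g_def)
    also have "exp (of_real s * l) * (- (?E s ** X ** Y)) $ i $ j + exp (of_real s * l) * l * (?E s ** Y) $ i $ j
       = g' s $ i $ j"
    proof -
      have "?E s ** ?Z = ?E s ** X ** Y - mat_scale l (?E s ** Y)"
        by (simp add: bounded_bilinear.diff_left[OF bounded_bilinear_matrix_mult]
           bounded_bilinear.diff_right[OF bounded_bilinear_matrix_mult] mat_eq_mat_scale[of l]
           mat_scale_mult_left mat_scale_mult_right matrix_mul_assoc)
      then have entry: "(?E s ** ?Z) $ i $ j = (?E s ** X ** Y) $ i $ j - l * (?E s ** Y) $ i $ j"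
        by simp
      show ?thesis unfolding g'_def
        by (simp only: mat_scale_nth entry) (simp add: algebra_simps)
    qed
    finally show "((\<lambda>s. g s $ i $ j) has_vector_derivative g' s $ i $ j) (at s)" .
  qed
  have bound: "norm (?E s ** Y) \<le> (norm Y * norm (mat 1 :: complex^'r^'r) + K / (Re l - d)) * exp (- d * s)" if "s \<ge> 0" for s
  proof -
    have "norm (g s - g 0) \<le> \<phi> s - \<phi> 0"
    proof (cases "s = 0")
      case False
      then have "0 < s" using that by simp
      then show ?thesis
      proof (rule differentiable_bound_general)
        show "continuous_on {0..s} g"
          using dg by (meson continuous_at_imp_continuous_on has_vector_derivative_continuous)
        show "continuous_on {0..s} \<phi>"
          unfolding \<phi>_def by (intro continuous_intros)
        fix x :: real assume "0 < x"
        show "(g has_vector_derivative g' x) (at x)" by (rule dg)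
        show "(\<phi> has_vector_derivative K * exp ((Re l - d) * x)) (at x)"
          unfolding \<phi>_def has_real_derivative_iff_has_vector_derivative[symmetric]
          using d by (auto intro!: derivative_eq_intros)
        have "norm (g' x) \<le> exp (x * Re l) * (K * exp (- d * x))"
          using K'[of x] \<open>0 < x\<close> by (simp add: g'_def norm_mat_scale mult_left_mono)
        also have "\<dots> = K * exp ((Re l - d) * x)"
          by (simp add: algebra_simps flip: exp_add)
        finally show "norm (g' x) \<le> K * exp ((Re l - d) * x)" .
      qed
    qed simp
    moreover have "norm (g 0) \<le> norm Y * norm (mat 1 :: complex^'r^'r)"
      using norm_matrix_mult_le[of "mat 1" Y] by (simp add: g_def mult.commute)
    moreover have "\<phi> 0 \<ge> 0" using \<open>K \<ge> 0\<close> d by (simp add: \<phi>_def)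
    ultimately have "norm (g s) \<le> norm Y * norm (mat 1 :: complex^'r^'r) + \<phi> s"
      using norm_triangle_ineq2[of "g s" "g 0"] by linarith
    then have "exp (s * Re l) * norm (?E s ** Y) \<le> norm Y * norm (mat 1 :: complex^'r^'r) + \<phi> s"
      by (simp add: g_def norm_mat_scale)
    \<comment> \<open>Undoing the factor in \<open>g\<close> turns \<open>\<phi>\<close> into decay
      at rate \<open>d\<close>; the initial value decays at the faster rate
      \<open>Re l\<close>.\<close>
    then have "exp (- (s * Re l)) * (exp (s * Re l) * norm (?E s ** Y)) \<le> exp (- (s * Re l)) * (norm Y * norm (mat 1 :: complex^'r^'r) + \<phi> s)"
      by (intro mult_left_mono) auto
    then have "norm (?E s ** Y) \<le> exp (- (s * Re l)) * (norm Y * norm (mat 1 :: complex^'r^'r)) + exp (- (s * Re l)) * \<phi> s"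
      by (simp only: mult.assoc[symmetric] distrib_left exp_add[symmetric]) simp
    also have "exp (- (s * Re l)) * \<phi> s = K / (Re l - d) * exp (- d * s)"
      by (simp add: \<phi>_def algebra_simps flip: exp_add)
    also have "exp (- (s * Re l)) * (norm Y * norm (mat 1 :: complex^'r^'r)) \<le> exp (- d * s) * (norm Y * norm (mat 1 :: complex^'r^'r))"
      using d that mult_right_mono[of d "Re l" s] by (intro mult_right_mono) (auto simp: mult.commute)
    finally show ?thesis by (simp add: algebra_simps)
  qed
  show ?thesis
    unfolding exp_decaying_def using d(1) bound by blast
qed

text \<open>Induction on the degree, splitting off a root \<open>l\<close>. If
  \<open>Re l > 0\<close>, the factor moves into \<open>Y\<close> and the differential equation
  recovers the decay of \<open>Y\<close>. Otherwise \<open>X - mat l\<close> is injective by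
  positive stability and can be cancelled.\<close>

lemma exp_decaying_of_annihilating_poly:
  assumes "positive_stable X"
  shows "p \<noteq> 0 \<Longrightarrow> mat_poly p X ** Y = 0 \<Longrightarrow> exp_decaying X Y"
proof (induction "degree p" arbitrary: p Y)
  case 0
  then obtain c where "p = [:c:]" "c \<noteq> 0"
    by (metis degree_eq_zeroE pCons_eq_0_iff)
  then have "mat_scale c Y = 0"
    using "0.prems" by (simp add: mat_eq_mat_scale[of c] mat_scale_mult_left)
  then have "Y = 0"
    using \<open>c \<noteq> 0\<close> by (simp add: vec_eq_iff)
  then show ?case
    unfolding exp_decaying_def by (intro exI[of _ 0] exI[of _ 1]) simp
next
  case (Suc n)
  then have "\<not> constant (poly p)"
    by (simp add: constant_degree)
  then obtain l where "poly p l = 0"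
    using fundamental_theorem_of_algebra by blast
  then obtain q where q: "p = [:- l, 1:] * q"
    by (auto simp: poly_eq_0_iff_dvd)
  have "q \<noteq> 0" using Suc.prems q by auto
  then have deg: "n = degree q"
    using Suc.hyps(2) unfolding q by (subst (asm) degree_mult_eq) auto
  show ?case
  proof (cases "Re l > 0")
    case True
    have "mat_poly q X ** ((X - mat l) ** Y) = 0"
      using Suc.prems(2) unfolding q mat_poly_linear_factor(2) by (simp add: matrix_mul_assoc)
    from exp_decaying_step[OF Suc.hyps(1)[OF deg \<open>q \<noteq> 0\<close> this] True] show ?thesis .
  next
    case False
    have "(X - mat l) ** (mat_poly q X ** Y) = 0"
      using Suc.prems(2) unfolding q mat_poly_linear_factor(1) by (simp add: matrix_mul_assoc)
    then have "mat_poly q X ** Y = 0"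
      using positive_stable_kernel[OF assms] False by (metis not_less)
    from Suc.hyps(1)[OF deg \<open>q \<noteq> 0\<close> this] show ?thesis .
  qed
qed

lemma positive_stable_exp_decay:
  assumes "positive_stable X"
  obtains K c where "c > 0" and "\<And>s. s \<ge> 0 \<Longrightarrow> norm (mat_exp ((- s) *\<^sub>R X)) \<le> K * exp (- c * s)"
proof -
  obtain p where p: "p \<noteq> 0" "mat_poly p X = 0"
    by (rule exists_annihilating_poly)
  have "exp_decaying X (mat 1)"
    by (rule exp_decaying_of_annihilating_poly[OF assms p(1)]) (simp add: p(2))
  then show ?thesis
    using that unfolding exp_decaying_def by auto
qed

section \<open>Interchange of sum and integral\<close>

text \<open>On a set of finite measure the constant \<open>b\<close> is an integrable majorant of
  all finite sums of norms. After an enumeration of the indices this is the termwise integration of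
  a series; the bound on finite sums in any order makes the enumeration harmless.\<close>

lemma has_sum_set_lebesgue_integral:
  fixes f :: "'k::countable \<Rightarrow> 'a \<Rightarrow> 'b::{banach,second_countable_topology}"
  assumes inf: "infinite (UNIV :: 'k set)"
    and S: "S \<in> sets M" "emeasure M S < \<infinity>"
    and meas: "\<And>k. set_borel_measurable M S (f k)"
    and bound: "\<And>u F. u \<in> S \<Longrightarrow> finite F \<Longrightarrow> (\<Sum>k\<in>F. norm (f k u)) \<le> b"
    and hs: "\<And>u. u \<in> S \<Longrightarrow> ((\<lambda>k. f k u) has_sum h u) UNIV"
  shows "set_integrable M S h"
    and "((\<lambda>k. LINT u:S|M. f k u) has_sum (LINT u:S|M. h u)) UNIV"
proof -
  define e :: "nat \<Rightarrow> 'k" where "e = from_nat_into UNIV"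
  have e: "bij_betw e UNIV UNIV"
    unfolding e_def using inf by (intro bij_betw_from_nat_into) auto
  then have inj: "inj e" by (simp add: bij_betw_def)
  define F where "F i u = indicator S u *\<^sub>R f (e i) u" for i u
  define B where "B u = indicator S u * b" for u :: 'a
  have intB: "integrable M B"
    unfolding B_def using S by (intro integrable_mult_left integrable_real_indicator) auto
  have FB: "(\<Sum>i<n. norm (F i u)) \<le> B u" for n u
  proof (cases "u \<in> S")
    case True
    have "(\<Sum>i<n. norm (F i u)) = (\<Sum>k\<in>e ` {..<n}. norm (f k u))"
      using True inj by (subst sum.reindex) (auto simp: F_def inj_on_def inj_def)
    also have "\<dots> \<le> B u"
      using bound[OF True, of "e ` {..<n}"] True by (simp add: B_def)
    finally show ?thesis .
  qed (simp add: F_def B_def)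
  \<comment> \<open>The empty partial sum already gives nonnegativity.\<close>
  have B0: "B u \<ge> 0" for u
    using FB[where n = 0] by simp
  have F1: "norm (F i u) \<le> B u" for i u
    using FB[where n = "Suc i" and u = u] sum_nonneg[of "{..<i}" "\<lambda>i. norm (F i u)"] by simp
  have measF: "F i \<in> borel_measurable M" for i
    using meas[of "e i"] by (simp add: set_borel_measurable_def F_def[abs_def])
  have intF: "integrable M (F i)" for i
    by (rule Bochner_Integration.integrable_bound[OF intB measF]) (use F1 B0 in auto)
  have sumF: "summable (\<lambda>i. norm (F i u))" for u
    by (rule summableI_nonneg_bounded[OF _ FB]) auto
  have sumI: "summable (\<lambda>i. \<integral>u. norm (F i u) \<partial>M)"
  proof (rule summableI_nonneg_bounded)
    fix n
    have "(\<Sum>i<n. \<integral>u. norm (F i u) \<partial>M) = (\<integral>u. (\<Sum>i<n. norm (F i u)) \<partial>M)"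
      using intF by (subst Bochner_Integration.integral_sum) auto
    also have "\<dots> \<le> integral\<^sup>L M B"
      using intF intB FB by (intro integral_mono) auto
    finally show "(\<Sum>i<n. \<integral>u. norm (F i u) \<partial>M) \<le> integral\<^sup>L M B" .
  qed simp
  have suminfF: "(\<Sum>i. F i u) = indicator S u *\<^sub>R h u" for u
  proof (cases "u \<in> S")
    case True
    then have "((\<lambda>i. f (e i) u) has_sum h u) UNIV"
      using hs[OF True] has_sum_reindex_bij_betw[OF e, of "\<lambda>k. f k u"] by simp
    then show ?thesis
      using True by (auto simp: F_def dest!: has_sum_imp_sums sums_unique)
  qed (simp add: F_def)
  show "set_integrable M S h"
    using integrable_suminf[OF intF _ sumI] sumF by (simp add: suminfF set_integrable_def)
  have "(\<lambda>i. integral\<^sup>L M (F i)) sums (LINT u:S|M. h u)"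
    using sums_integral[OF intF _ sumI] sumF by (simp add: suminfF set_lebesgue_integral_def)
  \<comment> \<open>Absolute convergence turns the ordered sum into an unordered one, which can then
    be carried back along the bijection \<open>e\<close>.\<close>
  moreover have "summable (\<lambda>i. norm (integral\<^sup>L M (F i)))"
    by (rule summable_comparison_test'[OF sumI, of 0]) (auto intro: integral_norm_bound)
  ultimately have "((\<lambda>i. integral\<^sup>L M (F i)) has_sum (LINT u:S|M. h u)) UNIV"
    by (intro norm_summable_imp_has_sum)
  then show "((\<lambda>k. LINT u:S|M. f k u) has_sum (LINT u:S|M. h u)) UNIV"
    using has_sum_reindex_bij_betw[OF e, of "\<lambda>k. LINT u:S|M. f k u"]
    by (simp add: F_def[abs_def] set_lebesgue_integral_def)
qed

text \<open>Products of absolutely convergent families, with the order of the factors kept as for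
  matrices. The first conclusion allows the second to be iterated for three factors.\<close>

lemma bounded_bilinear_has_sum_Times:
  fixes prod :: "'a::real_normed_vector \<Rightarrow> 'b::real_normed_vector \<Rightarrow> 'c::banach"
  assumes "bounded_bilinear prod"
    and f: "(\<lambda>i. norm (f i)) summable_on A" "(f has_sum x) A"
    and g: "(\<lambda>j. norm (g j)) summable_on B" "(g has_sum y) B"
  shows "(\<lambda>p. norm (case p of (i, j) \<Rightarrow> prod (f i) (g j))) summable_on A \<times> B"
    and "((\<lambda>(i, j). prod (f i) (g j)) has_sum prod x y) (A \<times> B)"
proof -
  interpret bounded_bilinear prod by fact
  obtain K where K: "K > 0" "\<And>a b. norm (prod a b) \<le> norm a * norm b * K"
    using pos_bounded by blast
  have "(\<lambda>(i, j). norm (f i) * norm (g j)) summable_on A \<times> B"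
    using f(1) g(1) by (intro summable_on_SigmaI[where g = "\<lambda>i. norm (f i) * (\<Sum>\<^sub>\<infinity>j\<in>B. norm (g j))"])
      (auto intro!: has_sum_cmult_right summable_on_cmult_left)
  then have "(\<lambda>p. (case p of (i, j) \<Rightarrow> norm (f i) * norm (g j)) * K) summable_on A \<times> B"
    by (rule summable_on_cmult_left)
  then show abs: "(\<lambda>p. norm (case p of (i, j) \<Rightarrow> prod (f i) (g j))) summable_on A \<times> B"
    by (rule summable_on_comparison_test) (use K in auto)
  \<comment> \<open>Absolute summability permits summing over \<open>j\<close> first, then over
    \<open>i\<close>.\<close>
  show "((\<lambda>(i, j). prod (f i) (g j)) has_sum prod x y) (A \<times> B)"
    by (rule has_sum_SigmaI[where g = "\<lambda>i. prod (f i) y"])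
      (use abs_summable_summable[OF abs] has_sum_bounded_linear[OF bounded_linear_right g(2)]
         has_sum_bounded_linear[OF bounded_linear_left f(2)] in auto)
qed

section \<open>Scalar majorants of the matrix binomial series\<close>

text \<open>
  Here \<open>norm (mat 1)\<close> is the square root of the dimension, so \<open>norm (B + mat n) \<le> norm B + n\<close>
  fails; the shift has to be bounded together with the factor to its left.
\<close>

lemma norm_mat_pochhammer_le:
  fixes B :: "complex^'r^'r"
  shows "norm (mat_pochhammer B n) \<le> norm (mat 1 :: complex^'r^'r) * pochhammer (norm B) n"
proof (induction n)
  case (Suc n)
  let ?P = "mat_pochhammer B n"
  have "norm (mat_pochhammer B (Suc n)) = norm (?P ** B + mat_scale (of_nat n) ?P)"
    by (simp add: matrix_add_ldistrib mult_mat)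
  also have "\<dots> \<le> norm ?P * norm B + norm ?P * of_nat n"
    using norm_matrix_mult_le[of ?P B]
    by (intro norm_triangle_le) (simp add: norm_mat_scale mult.commute)
  also have "\<dots> \<le> norm (mat 1 :: complex^'r^'r) * pochhammer (norm B) n * (norm B + of_nat n)"
    using mult_right_mono[OF Suc.IH, of "norm B + of_nat n"] by (simp add: algebra_simps)
  finally show ?case by (simp add: pochhammer_Suc mult_ac)
qed simp

lemma pochhammer_series_sums:
  fixes u b :: real
  assumes "\<bar>u\<bar> < 1"
  shows "(\<lambda>n. pochhammer b n / fact n * u ^ n) sums ((1 - u) powr (- b))"
proof -
  have "((- b) gchoose n) * (- u) ^ n = pochhammer b n / fact n * u ^ n" for n
  proof -
    have "(- 1 :: real) ^ n * (- u) ^ n = u ^ n"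
      by (simp flip: power_mult_distrib)
    then show ?thesis by (simp add: gbinomial_pochhammer mult_ac)
  qed
  then show ?thesis
    using gen_binomial_real[of "- u" "- b"] assms by simp
qed

lemma pochhammer_real_nonneg: "b \<ge> 0 \<Longrightarrow> pochhammer (b::real) n \<ge> 0"
  by (induction n) (auto simp: pochhammer_Suc)

text \<open>The scalar series with \<open>norm B\<close> and \<open>u\<close> in place of
  \<open>B\<close> and \<open>s\<close> has nonnegative terms, so its sum bounds every finite sum.
  This is the growth as \<open>u\<close> tends to 1 that the weight must absorb.\<close>

lemma mat_binomial_term_sum_le:
  fixes B :: "complex^'r^'r"
  assumes "norm s \<le> u" "0 \<le> u" "u < 1" "finite I"
  shows "(\<Sum>n\<in>I. norm (mat_scale (s ^ n / fact n) (mat_pochhammer B n)))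
    \<le> norm (mat 1 :: complex^'r^'r) * (1 - u) powr (- norm B)"
proof -
  let ?k = "norm (mat 1 :: complex^'r^'r)"
  let ?a = "\<lambda>n. pochhammer (norm B) n / fact n * u ^ n"
  have a: "?a sums ((1 - u) powr (- norm B))"
    using assms by (intro pochhammer_series_sums) auto
  have "(\<Sum>n\<in>I. norm (mat_scale (s ^ n / fact n) (mat_pochhammer B n))) \<le> (\<Sum>n\<in>I. ?k * ?a n)"
  proof (rule sum_mono)
    fix n
    have "norm (mat_scale (s ^ n / fact n) (mat_pochhammer B n)) = norm s ^ n / fact n * norm (mat_pochhammer B n)"
      by (simp add: norm_mat_scale norm_divide norm_power)
    also have "\<dots> \<le> u ^ n / fact n * (?k * pochhammer (norm B) n)"
      using assms norm_mat_pochhammer_le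
      by (intro mult_mono divide_right_mono power_mono) auto
    finally show "norm (mat_scale (s ^ n / fact n) (mat_pochhammer B n)) \<le> ?k * ?a n"
      by (simp add: mult_ac)
  qed
  also have "\<dots> \<le> ?k * (1 - u) powr (- norm B)"
    unfolding sum_distrib_left[symmetric] sums_unique[OF a]
    using assms sums_summable[OF a]
    by (intro mult_left_mono sum_le_suminf) (auto intro!: pochhammer_real_nonneg mult_nonneg_nonneg divide_nonneg_pos)
  finally show ?thesis .
qed

section \<open>The integral representation\<close>

text \<open>For \<open>t \<le> 1\<close> the modulus of \<open>Ln t\<close> is
  \<open>- ln t\<close>, so the bound on the exponential becomes a negative power of
  \<open>t\<close>.\<close>

lemma norm_mat_powr_le:
  fixes M :: "complex^'r^'r"
  assumes "0 < t" "t \<le> 1"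
  shows "norm (mat_powr (of_real t) M) \<le> norm (mat 1 :: complex^'r^'r) * t powr (- norm M)"
proof -
  have "norm (mat_scale (Ln (of_real t)) M) = - ln t * norm M"
    using assms by (simp add: norm_mat_scale Ln_of_real)
  then show ?thesis
    using norm_mat_exp_le[of "mat_scale (Ln (of_real t)) M"] assms
    by (simp add: mat_powr_def powr_def mult.commute)
qed

text \<open>The inequality \<open>x \<le> exp x\<close> at \<open>x = c * s / p\<close>, raised to
  the power \<open>p\<close>.\<close>

lemma powr_le_exp:
  fixes p c s :: real
  assumes "p > 0" "c > 0" "s \<ge> 0"
  shows "s powr p \<le> (p / c) powr p * exp (c * s)"
proof -
  have "c * s / p \<le> exp (c * s / p)"
    using exp_ge_add_one_self[of "c * s / p"] by linarith
  then have "s \<le> p / c * exp (c * s / p)"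
    using assms by (simp add: field_simps)
  then have "s powr p \<le> (p / c * exp (c * s / p)) powr p"
    using assms by (intro powr_mono2) auto
  also have "\<dots> = (p / c) powr p * exp (c * s)"
    using assms by (subst powr_mult) (auto simp: exp_powr_real)
  finally show ?thesis .
qed

lemma bounded_linear_mat_scale: "bounded_linear (mat_scale c)"
  by (rule bounded_linear_intro[where K = "norm c"])
    (auto simp: norm_mat_scale mat_scale_add vec_eq_iff algebra_simps)

lemma continuous_on_mat_exp:
  fixes M :: "complex^'r^'r"
  assumes "continuous_on S g"
  shows "continuous_on S (\<lambda>u. mat_exp (mat_scale (g u) M))"
proof -
  have "isCont (\<lambda>c. mat_exp (mat_scale c M)) c" for c
    unfolding isCont_def
    by (intro vec_tendstoI) (metis DERIV_isCont isCont_def mat_exp_nth_has_field_derivative)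
  then have "continuous_on UNIV (\<lambda>c. mat_exp (mat_scale c M))"
    by (simp add: continuous_at_imp_continuous_on)
  from continuous_on_compose2[OF this assms] show ?thesis by simp
qed

lemmas continuous_on_matrix_mult = bounded_bilinear.continuous_on[OF bounded_bilinear_matrix_mult]

text \<open>The common part of the extended beta integrand and the Lauricella integrand, separated
  from the binomial factors.\<close>

definition ext_beta_weight ::
    "complex^'r^'r \<Rightarrow> complex^'r^'r \<Rightarrow> complex^'r^'r \<Rightarrow> real \<Rightarrow> complex^'r^'r"
  where "ext_beta_weight P Q X u =
    mat_powr (complex_of_real u) (P - mat 1) ** mat_powr (complex_of_real (1 - u)) (Q - mat 1)
    ** mat_exp ((- 1 / (u * (1 - u))) *\<^sub>R X)"

lemma continuous_on_ext_beta_weight: "continuous_on {0<..<1} (ext_beta_weight P Q X)"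
proof -
  have "continuous_on {0<..<1} (\<lambda>u :: real. Ln (of_real u))"
    and "continuous_on {0<..<1} (\<lambda>u :: real. Ln (of_real (1 - u)))"
    and "continuous_on {0<..<1} (\<lambda>u :: real. of_real (- 1 / (u * (1 - u))) :: complex)"
    by (auto intro!: continuous_intros simp: complex_nonpos_Reals_iff)
  then show ?thesis
    unfolding ext_beta_weight_def[abs_def] mat_powr_def mat_scale_of_real[symmetric]
    by (intro continuous_on_matrix_mult continuous_on_mat_exp)
qed

text \<open>With \<open>s = 1 / (u * (1 - u))\<close>, both \<open>1 / u\<close> and
  \<open>1 / (1 - u)\<close> are at most \<open>s\<close>. All singular factors become powers of
  \<open>s\<close>, which the decay \<open>exp (- c * s)\<close> absorbs; \<open>N\<close> leaves
  room for the binomial series.\<close>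

lemma ext_beta_weight_bounded:
  fixes P Q X :: "complex^'r^'r"
  assumes "positive_stable X" "N \<ge> 0"
  obtains b where "b \<ge> 0"
    and "\<And>u. 0 < u \<Longrightarrow> u < 1 \<Longrightarrow> norm (ext_beta_weight P Q X u) * (1 - u) powr (- N) \<le> b"
proof -
  obtain K c where c: "c > 0"
    and K: "\<And>s. s \<ge> 0 \<Longrightarrow> norm (mat_exp ((- s) *\<^sub>R X)) \<le> K * exp (- c * s)"
    using positive_stable_exp_decay[OF assms(1)] by blast
  have "K \<ge> 0" using order_trans[OF norm_ge_zero K[of 0]] by simp
  let ?k = "norm (mat 1 :: complex^'r^'r)"
  define \<alpha> \<beta> where "\<alpha> = norm (P - mat 1)" and "\<beta> = norm (Q - mat 1)"
  \<comment> \<open>The total exponent of \<open>s\<close>, raised by 1 to be strictly positive as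
    \<open>powr_le_exp\<close> demands; raising it only enlarges the power since
    \<open>s \<ge> 1\<close>.\<close>
  define p where "p = \<alpha> + \<beta> + N + 1"
  have "p > 0" using assms(2) by (simp add: p_def \<alpha>_def \<beta>_def add_nonneg_pos)
  define b where "b = ?k * ?k * K * (p / c) powr p"
  have "norm (ext_beta_weight P Q X u) * (1 - u) powr (- N) \<le> b" if u: "0 < u" "u < 1" for u
  proof -
    define s where "s = 1 / (u * (1 - u))"
    have s: "s \<ge> 1" "1 / u \<le> s" "1 / (1 - u) \<le> s"
      using u mult_left_le[of u "1 - u"] mult_left_le[of "1 - u" u] mult_le_one[of u "1 - u"]
      by (auto simp: s_def intro!: divide_left_mono mult_pos_pos simp: mult.commute)
    have *: "u powr (- a) \<le> s powr a" "(1 - u) powr (- a) \<le> s powr a" if "a \<ge> 0" for a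
    proof -
      show "u powr (- a) \<le> s powr a"
        using powr_mono2[of a "1 / u" s] s u that by (simp add: powr_minus_divide powr_divide)
      show "(1 - u) powr (- a) \<le> s powr a"
        using powr_mono2[of a "1 / (1 - u)" s] s u that by (simp add: powr_minus_divide powr_divide)
    qed
    have "norm (ext_beta_weight P Q X u) \<le>
       norm (mat_powr (of_real u) (P - mat 1)) * norm (mat_powr (of_real (1 - u)) (Q - mat 1)) *
       norm (mat_exp ((- s) *\<^sub>R X))"
      unfolding ext_beta_weight_def s_def
      by (intro order_trans[OF norm_matrix_mult_le] mult_mono norm_matrix_mult_le) auto
    also have "\<dots> \<le> (?k * u powr (- \<alpha>)) * (?k * (1 - u) powr (- \<beta>)) * (K * exp (- c * s))"
      unfolding \<alpha>_def \<beta>_def using u s K[of s]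
      by (intro mult_mono norm_mat_powr_le) auto
    also have "\<dots> \<le> (?k * s powr \<alpha>) * (?k * s powr \<beta>) * (K * exp (- c * s))"
      using * \<open>K \<ge> 0\<close> by (intro mult_mono) (auto simp: \<alpha>_def \<beta>_def)
    finally have "norm (ext_beta_weight P Q X u) * (1 - u) powr (- N)
        \<le> (?k * s powr \<alpha>) * (?k * s powr \<beta>) * (K * exp (- c * s)) * s powr N"
      using * assms(2) \<open>K \<ge> 0\<close> by (intro mult_mono) auto
    also have "\<dots> = ?k * ?k * K * exp (- c * s) * s powr (\<alpha> + \<beta> + N)"
      by (simp add: powr_add)
    also have "\<dots> \<le> ?k * ?k * K * exp (- c * s) * ((p / c) powr p * exp (c * s))"
    proof -
      have "s powr (\<alpha> + \<beta> + N) \<le> s powr p"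
        using s by (intro powr_mono) (auto simp: p_def)
      also have "\<dots> \<le> (p / c) powr p * exp (c * s)"
        using powr_le_exp[OF \<open>p > 0\<close> c, of s] s by simp
      finally show ?thesis
        using \<open>K \<ge> 0\<close> by (intro mult_left_mono) auto
    qed
    also have "\<dots> = b"
      by (simp add: b_def exp_minus field_simps)
    finally show ?thesis .
  qed
  moreover have "b \<ge> 0" using \<open>K \<ge> 0\<close> by (simp add: b_def)
  ultimately show ?thesis using that by blast
qed

lemma set_borel_measurable_lborel_continuous:
  fixes f :: "real \<Rightarrow> 'b::real_normed_vector"
  assumes "continuous_on {0<..<1} f"
  shows "set_borel_measurable lborel {0<..<1} f"
  using set_measurable_continuous_on[OF _ assms] by (simp add: set_borel_measurable_def)

text \<open>The case \<open>N = 0\<close> of the previous bound makes the weight bounded on an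
  interval of finite length, and \<open>u ^ k\<close> is at most 1 there.\<close>

lemma ext_beta_weight_power_integrable:
  fixes P Q X :: "complex^'r^'r"
  assumes "positive_stable X"
  shows "set_integrable lborel {0<..<1} (\<lambda>u. u ^ k *\<^sub>R ext_beta_weight P Q X u)"
proof -
  obtain b where b: "b \<ge> 0"
    and le: "\<And>u. 0 < u \<Longrightarrow> u < 1 \<Longrightarrow> norm (ext_beta_weight P Q X u) * (1 - u) powr (- 0) \<le> b"
    using ext_beta_weight_bounded[OF assms order_refl] by blast
  have I: "set_integrable lborel {0<..<1::real} (\<lambda>u. b)"
    unfolding set_integrable_def by (intro integrable_scaleR_left integrable_real_indicator) auto
  show ?thesis
  proof (rule set_integrable_bound[OF I])
    show "set_borel_measurable lborel {0<..<1} (\<lambda>u. u ^ k *\<^sub>R ext_beta_weight P Q X u)"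
      by (intro set_borel_measurable_lborel_continuous continuous_intros continuous_on_ext_beta_weight)
    have "norm (u ^ k *\<^sub>R ext_beta_weight P Q X u) \<le> norm b" if "u \<in> {0<..<1}" for u
    proof -
      have "u ^ k * norm (ext_beta_weight P Q X u) \<le> 1 * norm (ext_beta_weight P Q X u)"
        using that by (intro mult_right_mono power_le_one) auto
      then show ?thesis using le[of u] b that by simp
    qed
    then show "AE u in lborel. u \<in> {0<..<1} \<longrightarrow> norm (u ^ k *\<^sub>R ext_beta_weight P Q X u) \<le> norm b"
      by auto
  qed
qed

lemma mat_ext_beta_shift:
  "mat_ext_beta (P + mat (of_nat k)) Q X = (LINT u:{0<..<1}|lborel. u ^ k *\<^sub>R ext_beta_weight P Q X u)"
  unfolding mat_ext_beta_def
proof (rule set_lebesgue_integral_cong)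
  show "\<forall>u. u \<in> {0<..<1} \<longrightarrow>
    mat_powr (complex_of_real u) (P + mat (of_nat k) - mat 1) ** mat_powr (complex_of_real (1 - u)) (Q - mat 1) **
      mat_exp ((- 1 / (u * (1 - u))) *\<^sub>R X) = u ^ k *\<^sub>R ext_beta_weight P Q X u"
  proof (intro allI impI)
    fix u :: real assume "u \<in> {0<..<1}"
    then have "mat_powr (of_real u) ((P - mat 1) + mat (of_nat k)) = mat_scale (of_real u ^ k) (mat_powr (of_real u) (P - mat 1))"
      by (intro mat_powr_add_mat_of_nat) auto
    moreover have "P + mat (of_nat k) - mat 1 = (P - mat 1) + mat (of_nat k)"
      by simp
    ultimately show "mat_powr (complex_of_real u) (P + mat (of_nat k) - mat 1) ** mat_powr (complex_of_real (1 - u)) (Q - mat 1) **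
      mat_exp ((- 1 / (u * (1 - u))) *\<^sub>R X) = u ^ k *\<^sub>R ext_beta_weight P Q X u"
      by (simp only: ext_beta_weight_def mat_scale_of_real[symmetric] of_real_power mat_scale_mult_left)
  qed
qed simp

section \<open>The triple series under the integral sign\<close>

abbreviation mat_binomial_term :: "complex^'r^'r \<Rightarrow> complex \<Rightarrow> nat \<Rightarrow> complex^'r^'r"
  where "mat_binomial_term B s n \<equiv> mat_scale (s ^ n / fact n) (mat_pochhammer B n)"

text \<open>The powers of \<open>u\<close> and the factorials are distributed over the three
  binomial terms, and the product is nested to the right to match the iterated product of
  series.\<close>

definition lauricella_term_integrand ::
    "complex^'r^'r \<Rightarrow> complex^'r^'r \<Rightarrow> complex^'r^'r \<Rightarrow> complex^'r^'r \<Rightarrow> complex^'r^'r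
      \<Rightarrow> complex^'r^'r \<Rightarrow> complex \<Rightarrow> complex \<Rightarrow> complex \<Rightarrow> nat \<times> nat \<times> nat \<Rightarrow> real \<Rightarrow> complex^'r^'r"
  where "lauricella_term_integrand X A B B' B'' C z w v = (\<lambda>(m, n, p) u.
    ext_beta_weight A (C - A) X u ** (mat_binomial_term B (z * of_real u) m
      ** (mat_binomial_term B' (w * of_real u) n ** mat_binomial_term B'' (v * of_real u) p)))"

lemma lauricella_term_integrand_conv:
  "lauricella_term_integrand X A B B' B'' C z w v (m, n, p) u =
    mat_scale (z ^ m * w ^ n * v ^ p / (fact m * fact n * fact p))
      (u ^ (m + n + p) *\<^sub>R ext_beta_weight A (C - A) X u
        ** mat_pochhammer B m ** mat_pochhammer B' n ** mat_pochhammer B'' p)"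
  by (simp add: lauricella_term_integrand_def mat_scale_mult_left mat_scale_mult_right
      power_mult_distrib power_add matrix_mul_assoc mult_ac flip: mat_scale_of_real)

text \<open>The shift of the first beta argument becomes \<open>u ^ (m + n + p)\<close>. Right
  multiplication by the Pochhammer matrices and scaling form one bounded linear map, which passes
  through the integral.\<close>

lemma ext_lauricella_term_eq_integral:
  assumes "positive_stable X"
  shows "ext_lauricella_term X A B B' B'' C z w v k =
    (LINT u:{0<..<1}|lborel. lauricella_term_integrand X A B B' B'' C z w v k u)"
proof (cases k)
  case (fields m n p)
  define L where "L Y = mat_scale (z ^ m * w ^ n * v ^ p / (fact m * fact n * fact p))
      (Y ** mat_pochhammer B m ** mat_pochhammer B' n ** mat_pochhammer B'' p)" for Y
  have L: "bounded_linear L"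
    unfolding L_def[abs_def]
    by (intro bounded_linear_compose[OF bounded_linear_mat_scale]
        bounded_linear_compose[OF bounded_linear_matrix_mult_left] bounded_linear_ident)
  define g where "g u = u ^ (m + n + p) *\<^sub>R ext_beta_weight A (C - A) X u" for u
  have "ext_lauricella_term X A B B' B'' C z w v k = L (LINT u:{0<..<1}|lborel. g u)"
    by (simp only: fields ext_lauricella_term_def mat_ext_beta_shift g_def L_def split)
  also have "\<dots> = (LINT u:{0<..<1}|lborel. L (g u))"
    using ext_beta_weight_power_integrable[OF assms, of "m + n + p" A "C - A"]
    unfolding set_lebesgue_integral_def set_integrable_def g_def
    by (subst integral_bounded_linear[OF L, symmetric])
      (simp_all add: linear_scale[OF bounded_linear.linear[OF L]])
  finally show ?thesis
    by (simp only: fields lauricella_term_integrand_conv g_def L_def)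
qed

lemma lauricella_term_integrand_measurable:
  "set_borel_measurable lborel {0<..<1} (lauricella_term_integrand X A B B' B'' C z w v k)"
proof (cases k)
  case (fields m n p)
  show ?thesis
    unfolding fields lauricella_term_integrand_conv
    by (intro set_borel_measurable_lborel_continuous
        bounded_linear.continuous_on[OF bounded_linear_mat_scale]
        bounded_linear.continuous_on[OF bounded_linear_matrix_mult_left]
        continuous_intros continuous_on_ext_beta_weight)
qed

lemma lauricella_term_integrand_has_sum:
  assumes "norm z \<le> 1" "norm w \<le> 1" "norm v \<le> 1" "0 < u" "u < 1"
  shows "((\<lambda>k. lauricella_term_integrand X A B B' B'' C z w v k u)
    has_sum ext_lauricella_integrand X A B B' B'' C z w v u) UNIV"
proof -
  have binomial: "(\<lambda>n. norm (mat_binomial_term D (y * of_real u) n)) summable_on UNIV \<and>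
      (mat_binomial_term D (y * of_real u) has_sum mat_powr (1 - y * of_real u) (- D)) UNIV"
    if "norm y \<le> 1" for y and D :: "complex^'r^'r"
  proof -
    \<comment> \<open>Since \<open>u < 1\<close>, the series converges even when
      \<open>norm y = 1\<close>.\<close>
    have le: "norm (y * of_real u) \<le> u"
      using that assms by (simp add: norm_mult mult_left_le_one_le)
    have "summable (\<lambda>n. norm (mat_binomial_term D (y * of_real u) n))"
      using mat_binomial_term_sum_le[OF le] assms
      by (intro summableI_nonneg_bounded[where x = "norm (mat 1 :: complex^'r^'r) * (1 - u) powr (- norm D)"]) auto
    moreover have "mat_binomial_term D (y * of_real u) sums mat_powr (1 - y * of_real u) (- D)"
      using le assms by (intro mat_binomial_series) linarith
    ultimately show ?thesis
      by (auto intro: norm_summable_imp_has_sum norm_summable_imp_summable_on summable_nonneg_imp_summable_on)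
  qed
  note * = bounded_bilinear_has_sum_Times[OF bounded_bilinear_matrix_mult]
  note inner = *[OF conjunct1[OF binomial[OF assms(2)]] conjunct2[OF binomial[OF assms(2)]]
      conjunct1[OF binomial[OF assms(3)]] conjunct2[OF binomial[OF assms(3)]], of B' B'']
  note outer = *(2)[OF conjunct1[OF binomial[OF assms(1)]] conjunct2[OF binomial[OF assms(1)]] inner, of B]
  from has_sum_bounded_linear[OF bounded_linear_matrix_mult_right[of "ext_beta_weight A (C - A) X u"] outer]
  show ?thesis
    by (simp add: lauricella_term_integrand_def ext_lauricella_integrand_def ext_beta_weight_def
        case_prod_unfold matrix_mul_assoc)
qed

lemma lauricella_term_integrand_bounded:
  fixes A B B' B'' C X :: "complex^'r^'r"
  assumes "positive_stable X" "norm z \<le> 1" "norm w \<le> 1" "norm v \<le> 1"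
  obtains b where "\<And>u F. u \<in> {0<..<1} \<Longrightarrow> finite F \<Longrightarrow>
    (\<Sum>k\<in>F. norm (lauricella_term_integrand X A B B' B'' C z w v k u)) \<le> b"
proof -
  let ?k = "norm (mat 1 :: complex^'r^'r)"
  let ?N = "norm B + norm B' + norm B''"
  obtain b where b: "b \<ge> 0"
    "\<And>u. 0 < u \<Longrightarrow> u < 1 \<Longrightarrow> norm (ext_beta_weight A (C - A) X u) * (1 - u) powr (- ?N) \<le> b"
    using ext_beta_weight_bounded[OF assms(1), of ?N] by auto
  have "(\<Sum>k\<in>F. norm (lauricella_term_integrand X A B B' B'' C z w v k u)) \<le> b * ?k ^ 3"
    if u: "u \<in> {0<..<1}" and "finite F" for u F
  proof -
    define t t' t'' where "t m = norm (mat_binomial_term B (z * of_real u) m)"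
      and "t' m = norm (mat_binomial_term B' (w * of_real u) m)"
      and "t'' m = norm (mat_binomial_term B'' (v * of_real u) m)" for m
    let ?W = "norm (ext_beta_weight A (C - A) X u)"
    \<comment> \<open>The projections enclose \<open>F\<close> in a box; all terms are nonnegative,
      and over the box the sum factors into three binomial sums.\<close>
    define I I' I'' where "I = fst ` F" and "I' = fst ` snd ` F" and "I'' = snd ` snd ` F"
    have fin: "finite I" "finite I'" "finite I''"
      using \<open>finite F\<close> by (auto simp: I_def I'_def I''_def)
    have F: "F \<subseteq> I \<times> I' \<times> I''"
      by (force simp: I_def I'_def I''_def)
    have le: "norm (y * of_real u) \<le> u" if "norm y \<le> 1" for y :: complex
      using that u by (simp add: norm_mult mult_left_le_one_le)
    have "(\<Sum>k\<in>F. norm (lauricella_term_integrand X A B B' B'' C z w v k u))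
        \<le> (\<Sum>k\<in>F. ?W * (case k of (m, n, p) \<Rightarrow> t m * (t' n * t'' p)))"
      unfolding lauricella_term_integrand_def t_def t'_def t''_def
      by (intro sum_mono)
        (auto intro!: order_trans[OF norm_matrix_mult_le] mult_left_mono split: prod.splits)
    also have "\<dots> = ?W * (\<Sum>(m, n, p)\<in>F. t m * (t' n * t'' p))"
      by (simp add: sum_distrib_left)
    also have "\<dots> \<le> ?W * (\<Sum>(m, n, p)\<in>I \<times> I' \<times> I''. t m * (t' n * t'' p))"
      using F fin by (intro mult_left_mono sum_mono2) (auto simp: t_def t'_def t''_def)
    also have "(\<Sum>(m, n, p)\<in>I \<times> I' \<times> I''. t m * (t' n * t'' p)) = sum t I * (sum t' I' * sum t'' I'')"
      by (simp add: sum_product sum.cartesian_product case_prod_unfold)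
    also have "?W * (sum t I * (sum t' I' * sum t'' I'')) \<le>
        ?W * ((?k * (1 - u) powr (- norm B)) * ((?k * (1 - u) powr (- norm B')) * (?k * (1 - u) powr (- norm B''))))"
      unfolding t_def t'_def t''_def using u fin le[OF assms(2)] le[OF assms(3)] le[OF assms(4)]
      by (intro mult_left_mono mult_mono mat_binomial_term_sum_le) (auto intro!: sum_nonneg mult_nonneg_nonneg)
    \<comment> \<open>The three powers of \<open>1 - u\<close> combine into the exponent
      \<open>- ?N\<close> for which the weight was bounded.\<close>
    also have "\<dots> = ?W * (1 - u) powr (- ?N) * ?k ^ 3"
      by (simp add: powr_add powr_diff powr_minus power3_eq_cube field_simps)
    also have "\<dots> \<le> b * ?k ^ 3"
      using b(2)[of u] u by (intro mult_right_mono) auto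
    finally show ?thesis .
  qed
  then show ?thesis using that by blast
qed

theorem theorem3p3:
  fixes A B B' B'' C X :: "complex^'r^'r" and z w v :: complex
  assumes "positive_stable A" and "positive_stable B" and "positive_stable B'"
    and "positive_stable B''" and "positive_stable C" and "positive_stable (C - A)"
    and "positive_stable X"
    and "A ** C = C ** A" and "A ** X = X ** A" and "C ** X = X ** C"
    and "C ** B = B ** C" and "C ** B' = B' ** C" and "C ** B'' = B'' ** C"
    and "norm z \<le> 1" and "norm w \<le> 1" and "norm v \<le> 1"
  shows "ext_lauricella_term X A B B' B'' C z w v summable_on UNIV
    \<and> set_integrable lborel {0<..<1} (ext_lauricella_integrand X A B B' B'' C z w v)
    \<and> ext_lauricella_FD3 X A B B' B'' C z w v =
        mat_Gamma C ** matrix_inv (mat_Gamma A) ** matrix_inv (mat_Gamma (C - A))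
        ** (LINT u:{0<..<1}|lborel. ext_lauricella_integrand X A B B' B'' C z w v u)"
proof -
  note X = \<open>positive_stable X\<close> and zwv = assms(14-16)
  obtain b where b: "\<And>u F. u \<in> {0<..<1} \<Longrightarrow> finite F \<Longrightarrow>
      (\<Sum>k\<in>F. norm (lauricella_term_integrand X A B B' B'' C z w v k u)) \<le> b"
    using lauricella_term_integrand_bounded[OF X zwv] by blast
  have hs: "((\<lambda>k. lauricella_term_integrand X A B B' B'' C z w v k u)
      has_sum ext_lauricella_integrand X A B B' B'' C z w v u) UNIV" if "u \<in> {0<..<1}" for u
    using that by (intro lauricella_term_integrand_has_sum[OF zwv]) auto
  have inf: "infinite (UNIV :: (nat \<times> nat \<times> nat) set)"
    by (simp add: finite_prod)
  \<comment> \<open>The two open premises are the measurability and the finite measure of the unit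
    interval.\<close>
  note interchange = has_sum_set_lebesgue_integral[where M = lborel and S = "{0<..<1}",
      OF inf _ _ lauricella_term_integrand_measurable b hs]
  have sum: "(ext_lauricella_term X A B B' B'' C z w v has_sum
      (LINT u:{0<..<1}|lborel. ext_lauricella_integrand X A B B' B'' C z w v u)) UNIV"
    using interchange(2) by (simp add: ext_lauricella_term_eq_integral[OF X, abs_def])
  show ?thesis
    using interchange(1) sum
    by (auto simp: ext_lauricella_FD3_def summable_on_def infsumI)
qed

end
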